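(* Every matrix $A\in M(3,\mathbb{Z})$ whose norm is less than or equal to $6$ is of Frobenius type.
   Context: $M(k,\mathbb{Z})$ denotes the set of $k\times k$ matrices with integer entries whose characteristic polynomial is irreducible over $\mathbb{Q}$. The norm of a matrix is the sum of the absolute values of all its entries. For integers $a_1,\ldots,a_k$, the Frobenius matrix $M_{a_1,\ldots,a_k}$ is the $k\times k$ matrix obtained from the $(k-1)\times(k-1)$ identity matrix by adding a column of zeroes on the left and the row $(a_k,\ldots,a_1)$ at the bottom; that is, its $(i,i+1)$ entries equal $1$ for $1\le i\le k-1$, its last row is $(a_k,a_{k-1},\ldots,a_1)$, and all other entries are $0$. A matrix $A\in M(k,\mathbb{Z})$ is said to be of Frobenius type if there exist integers $a_1,\ldots,a_k$ and a matrix $X\in SL(k,\mathbb{Z})$ such that $XAX^{-1}$ commutes with $M_{a_1,\ldots,a_k}$. *)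

theory Defs
  imports "Jordan_Normal_Form.Char_Poly"
begin

(* M(k,Z) *)
definition irred_int_mats :: "nat \<Rightarrow> int mat set" where
  "irred_int_mats k =
     {A \<in> carrier_mat k k. irreducible (char_poly (map_mat rat_of_int A))}"

definition mat_norm1 :: "int mat \<Rightarrow> int" where
  "mat_norm1 A = (\<Sum>i<dim_row A. \<Sum>j<dim_col A. \<bar>A $$ (i, j)\<bar>)"

(* Only a 1, ..., a k are used.  Rows and columns are counted from 0 here,
   so the last row has a (k - j) in column j, i.e. it reads (a k, ..., a 1). *)
definition frobenius_mat :: "nat \<Rightarrow> (nat \<Rightarrow> int) \<Rightarrow> int mat" where
  "frobenius_mat k a =
     mat k k (\<lambda>(i, j). if i = k - 1 then a (k - j) else if j = i + 1 then 1 else 0)"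

definition SL_int :: "nat \<Rightarrow> int mat set" where
  "SL_int k = {X \<in> carrier_mat k k. det X = 1}"

(* Y is the two-sided inverse of X, which is unique and exists since det X = 1.
   Membership of A in irred_int_mats k is left to the place of use. *)
definition frobenius_type :: "nat \<Rightarrow> int mat \<Rightarrow> bool" where
  "frobenius_type k A \<longleftrightarrow>
     (\<exists>a. \<exists>X \<in> SL_int k. \<exists>Y \<in> carrier_mat k k.
        inverts_mat X Y \<and> inverts_mat Y X \<and>
        (X * A * Y) * frobenius_mat k a = frobenius_mat k a * (X * A * Y))"

end

theory Submission
  imports Defs
begin

text \<open>\<open>A\<close> is of Frobenius type as soon as some integer matrix \<open>B\<close> commuting with \<open>A\<close> has a row vector
  \<open>r\<close> for which \<open>r, r B, r B\<^sup>2\<close> is a basis of the integer lattice, i.e. has determinant \<open>\<plusminus>1\<close>. For the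
  finitely many matrices of norm at most 6, either an integer eigenvalue contradicts
  irreducibility, or a short \<open>r\<close> exists for \<open>B = A\<close> or for an integral \<open>B = (A\<^sup>2 + x A) / 2\<close> with
  \<open>\<bar>x\<bar> \<le> 1\<close>.\<close>

section \<open>Two general criteria: integer eigenvalues and cyclic row vectors\<close>

lemma irreducible_poly_root_degree:
  fixes p :: "'a :: field poly"
  assumes "irreducible p" and "poly p a = 0"
  shows "degree p = 1"
proof -
  obtain q where p: "p = [:-a, 1:] * q"
    using assms(2) by (metis poly_eq_0_iff_dvd dvdE)
  have "\<not> [:-a, 1:] dvd 1"
    by (simp add: is_unit_iff_degree)
  then have "q dvd 1"
    using irreducibleD[OF assms(1) p] by blast
  then have "degree q = 0" "q \<noteq> 0"
    by (auto simp: poly_dvd_1)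
  then show ?thesis
    unfolding p by (subst degree_mult_eq) auto
qed

text \<open>Such a \<open>t\<close> is a rational root of the characteristic polynomial, which has
  degree \<open>n\<close>. An irreducible polynomial with a root is linear, which would force
  \<open>n = 1\<close>.\<close>

lemma det_shift_eq_0_imp_not_irreducible:
  fixes A :: "int mat"
  assumes A: "A \<in> carrier_mat n n" and n: "n \<noteq> 1"
    and det: "det (A + (- t) \<cdot>\<^sub>m 1\<^sub>m n) = 0"
  shows "\<not> irreducible (char_poly (map_mat rat_of_int A))"
proof
  let ?A = "map_mat rat_of_int A"
  assume irr: "irreducible (char_poly ?A)"
  have cA: "?A \<in> carrier_mat n n"
    using A by simp
  have "char_matrix ?A (of_int t) = map_mat rat_of_int (A + (- t) \<cdot>\<^sub>m 1\<^sub>m n)"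
    using A by (intro eq_matI) (auto simp: char_matrix_def)
  then have "det (char_matrix ?A (of_int t)) = 0"
    using det by simp
  then have "poly (char_poly ?A) (of_int t) = 0"
    using eigenvalue_det[OF cA] eigenvalue_root_char_poly[OF cA] by simp
  from irreducible_poly_root_degree[OF irr this] show False
    using degree_monic_char_poly[OF cA] n by simp
qed

text \<open>If the rows of a unimodular \<open>X\<close> are \<open>r, r B, r B\<^sup>2, \<dots>\<close>, then \<open>X B X\<inverse>\<close> is a Frobenius matrix
  whose last row is whatever it has to be.\<close>

lemma frobenius_type_if_cyclic_commuting:
  assumes A: "A \<in> carrier_mat k k" and B: "B \<in> carrier_mat k k" and X: "X \<in> carrier_mat k k"
    and det: "det X = 1"
    and comm: "A * B = B * A"
    and rows: "\<And>i. Suc i < k \<Longrightarrow> row (X * B) i = row X (Suc i)"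
  shows "frobenius_type k A"
proof -
  define Y where "Y = adj_mat X"
  have Y: "Y \<in> carrier_mat k k" and XY: "X * Y = 1\<^sub>m k" and YX: "Y * X = 1\<^sub>m k"
    using adj_mat[OF X] det by (auto simp: Y_def)
  define F where "F = X * B * Y"
  have F: "F \<in> carrier_mat k k"
    using X B Y by (simp add: F_def)
  have XB: "X * B \<in> carrier_mat k k"
    using X B by simp
  \<comment> \<open>\<open>frobenius_mat\<close> puts \<open>a (k - j)\<close> into column
    \<open>j\<close> of its last row, and \<open>k - (k - j) = j\<close> for
    \<open>j < k\<close>.\<close>
  define a where "a = (\<lambda>m. F $$ (k - 1, k - m))"
  have "F = frobenius_mat k a"
  proof (rule eq_matI)
    fix i j assume "i < dim_row (frobenius_mat k a)" "j < dim_col (frobenius_mat k a)"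
    then have ij: "i < k" "j < k"
      by (auto simp: frobenius_mat_def)
    show "F $$ (i, j) = frobenius_mat k a $$ (i, j)"
    proof (cases "i = k - 1")
      case True
      then show ?thesis
        using ij by (simp add: frobenius_mat_def a_def)
    next
      case False
      then have i: "Suc i < k"
        using ij by simp
      \<comment> \<open>The row shift turns this entry into one of \<open>X * Y = 1\<close>, which
        yields the ones above the diagonal.\<close>
      have "F $$ (i, j) = row (X * B) i \<bullet> col Y j"
        unfolding F_def using ij X XB Y by simp
      also have "\<dots> = (X * Y) $$ (Suc i, j)"
        unfolding rows[OF i] using i ij X Y by simp
      also have "\<dots> = frobenius_mat k a $$ (i, j)"
        unfolding XY using i ij False by (auto simp: frobenius_mat_def)
      finally show ?thesis .
    qed
  qed (use F in \<open>auto simp: frobenius_mat_def\<close>)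
  have conj_mult: "(X * P * Y) * (X * Q * Y) = X * (P * Q) * Y"
    if P: "P \<in> carrier_mat k k" and Q: "Q \<in> carrier_mat k k" for P Q
  proof -
    have "(X * P * Y) * (X * Q * Y) = X * P * (Y * X) * Q * Y"
      using X Y P Q by (simp add: assoc_mult_mat[of _ k k _ k _ k])
    also have "\<dots> = X * (P * Q) * Y"
      unfolding YX using X Y P Q by (simp add: assoc_mult_mat[of _ k k _ k _ k])
    finally show ?thesis .
  qed
  \<comment> \<open>Conjugation by \<open>X\<close> is multiplicative, so \<open>comm\<close> passes
    to the conjugates.\<close>
  have "(X * A * Y) * F = F * (X * A * Y)"
    unfolding F_def conj_mult[OF A B] conj_mult[OF B A] comm ..
  with \<open>F = frobenius_mat k a\<close> show ?thesis
    unfolding frobenius_type_def SL_int_def inverts_mat_def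
    using X Y XY YX det by (intro exI[of _ a] bexI[of _ X] bexI[of _ Y]) auto
qed

section \<open>Integer 3x3 matrices as tuples, suited to evaluation\<close>

type_synonym vec3 = "int \<times> int \<times> int"
type_synonym mat3 = "vec3 \<times> vec3 \<times> vec3"

fun mat_of_mat3 :: "mat3 \<Rightarrow> int mat" where
  "mat_of_mat3 ((a, b, c), (d, e, f), (g, h, i)) =
     mat_of_rows_list 3 [[a, b, c], [d, e, f], [g, h, i]]"

fun det3 :: "mat3 \<Rightarrow> int" where
  "det3 ((a, b, c), (d, e, f), (g, h, i)) =
     a * (e * i - f * h) - b * (d * i - f * g) + c * (d * h - e * g)"

fun vec3_mult :: "vec3 \<Rightarrow> mat3 \<Rightarrow> vec3" where
  "vec3_mult (x, y, z) ((a, b, c), (d, e, f), (g, h, i)) =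
     (x * a + y * d + z * g, x * b + y * e + z * h, x * c + y * f + z * i)"

fun mat3_mult :: "mat3 \<Rightarrow> mat3 \<Rightarrow> mat3" where
  "mat3_mult (r, s, t) N = (vec3_mult r N, vec3_mult s N, vec3_mult t N)"

fun mat3_shift :: "mat3 \<Rightarrow> int \<Rightarrow> mat3" where
  "mat3_shift ((a, b, c), (d, e, f), (g, h, i)) t = ((a + t, b, c), (d, e + t, f), (g, h, i + t))"

fun mat3_half :: "mat3 \<Rightarrow> mat3" where
  "mat3_half ((a, b, c), (d, e, f), (g, h, i)) =
     ((a div 2, b div 2, c div 2), (d div 2, e div 2, f div 2), (g div 2, h div 2, i div 2))"

definition krylov :: "mat3 \<Rightarrow> vec3 \<Rightarrow> mat3" where
  "krylov M r = (r, vec3_mult r M, vec3_mult (vec3_mult r M) M)"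

definition cyclic_vec3 :: "mat3 \<Rightarrow> vec3 \<Rightarrow> bool" where
  "cyclic_vec3 M r \<longleftrightarrow> \<bar>det3 (krylov M r)\<bar> = 1"

lemma mat_of_mat3_carrier [simp]: "mat_of_mat3 M \<in> carrier_mat 3 3"
  by (cases M rule: mat_of_mat3.cases) (simp add: mat_of_rows_list_def numeral_3_eq_3)

lemma mat_of_mat3_mult: "mat_of_mat3 M * mat_of_mat3 N = mat_of_mat3 (mat3_mult M N)"
  by (cases M rule: mat_of_mat3.cases, cases N rule: mat_of_mat3.cases)
     (auto intro!: eq_matI
        simp: mat_of_rows_list_def scalar_prod_def numeral_3_eq_3 less_Suc_eq)

lemma mat_of_mat3_shift: "mat_of_mat3 M + t \<cdot>\<^sub>m 1\<^sub>m 3 = mat_of_mat3 (mat3_shift M t)"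
  by (cases M rule: mat_of_mat3.cases)
     (auto intro!: eq_matI simp: mat_of_rows_list_def numeral_3_eq_3 less_Suc_eq)

lemma det_mat_of_mat3: "det (mat_of_mat3 M) = det3 M"
proof -
  obtain a b c d e f g h i where M: "M = ((a, b, c), (d, e, f), (g, h, i))"
    by (cases M rule: mat_of_mat3.cases)
  have det2: "det P = P $$ (0, 0) * P $$ (1, 1) - P $$ (0, 1) * P $$ (1, 0)"
    if "P \<in> carrier_mat 2 2" for P :: "int mat"
    using that
    by (subst laplace_expansion_row[OF that, of 0])
       (auto simp: cofactor_def mat_delete_def det_single numeral_2_eq_2)
  have "det (mat_of_mat3 M) = (\<Sum>j<3. mat_of_mat3 M $$ (0, j) * cofactor (mat_of_mat3 M) 0 j)"
    by (rule laplace_expansion_row) auto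
  then show ?thesis
    by (simp add: M mat_of_rows_list_def cofactor_def mat_delete_def numeral_3_eq_3
        det2[unfolded numeral_2_eq_2] algebra_simps)
qed

text \<open>\<open>krylov N r\<close> serves as the conjugating matrix. If its determinant is -1,
  replacing \<open>r\<close> by its negative negates all three rows and hence the
  determinant.\<close>

lemma frobenius_type_mat_of_mat3:
  assumes comm: "mat3_mult M N = mat3_mult N M" and cyc: "cyclic_vec3 N r"
  shows "frobenius_type 3 (mat_of_mat3 M)"
proof -
  have *: "frobenius_type 3 (mat_of_mat3 M)" if "det3 (krylov N r) = 1" for r
  proof (rule frobenius_type_if_cyclic_commuting)
    show "mat_of_mat3 M * mat_of_mat3 N = mat_of_mat3 N * mat_of_mat3 M"
      by (simp add: mat_of_mat3_mult comm)
    show "det (mat_of_mat3 (krylov N r)) = 1"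
      using that by (simp add: det_mat_of_mat3)
    fix i :: nat
    assume "Suc i < 3"
    then show "row (mat_of_mat3 (krylov N r) * mat_of_mat3 N) i = row (mat_of_mat3 (krylov N r)) (Suc i)"
      unfolding mat_of_mat3_mult
      by (cases N rule: mat_of_mat3.cases; cases r)
         (auto intro!: eq_vecI simp: krylov_def mat_of_rows_list_def less_Suc_eq numeral_3_eq_3)
  qed auto
  obtain x y z where r: "r = (x, y, z)"
    by (cases r)
  have "det3 (krylov N (- x, - y, - z)) = - det3 (krylov N r)"
    by (cases N rule: mat_of_mat3.cases) (simp add: krylov_def r algebra_simps)
  with cyc *[of r] *[of "(- x, - y, - z)"] show ?thesis
    unfolding cyclic_vec3_def by linarith
qed

lemma not_irreducible_mat_of_mat3:
  assumes "det3 (mat3_shift M (- t)) = 0"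
  shows "\<not> irreducible (char_poly (map_mat rat_of_int (mat_of_mat3 M)))"
  using det_shift_eq_0_imp_not_irreducible[of "mat_of_mat3 M" 3 t] assms
  by (simp add: mat_of_mat3_shift det_mat_of_mat3)

section \<open>Enumeration of integer vectors and the search tests\<close>

fun l1_ball :: "nat \<Rightarrow> int \<Rightarrow> int list list" where
  "l1_ball 0 s = [[]]"
| "l1_ball (Suc n) s = concat (map (\<lambda>v. map ((#) v) (l1_ball n (s - \<bar>v\<bar>))) [-s..s])"

text \<open>This inclusion makes the later check exhaustive; surplus vectors would only add cases to
  it.\<close>

lemma in_l1_ballI:
  "length vs = n \<Longrightarrow> sum_list (map abs vs) \<le> s \<Longrightarrow> vs \<in> set (l1_ball n s)"
proof (induction n arbitrary: vs s)
  case (Suc n)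
  from Suc.prems(1) obtain v ws where vs: "vs = v # ws" "length ws = n"
    by (cases vs) auto
  have "0 \<le> sum_list (map abs ws)"
    by (rule sum_list_nonneg) auto
  then have "- s \<le> v" "v \<le> s" "sum_list (map abs ws) \<le> s - \<bar>v\<bar>"
    using Suc.prems(2) vs(1) by auto
  with Suc.IH[OF vs(2)] show ?case
    by (force simp: vs(1))
qed auto

text \<open>Unlike \<^const>\<open>list_ex\<close>, the constant \<^const>\<open>find\<close> stops at the first hit when evaluated by the simplifier.\<close>

definition any :: "('a \<Rightarrow> bool) \<Rightarrow> 'a list \<Rightarrow> bool" where
  "any P xs \<longleftrightarrow> \<not> Option.is_none (find P xs)"

lemma any_iff: "any P xs \<longleftrightarrow> (\<exists>x \<in> set xs. P x)"
  by (auto simp: any_def Option.is_none_def find_None_iff)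

definition unit_vecs :: "vec3 list" where
  "unit_vecs = [(1, 0, 0), (0, 1, 0), (0, 0, 1)]"

text \<open>Only one of \<open>\<plusminus>r\<close> is needed, so the entry \<open>-2\<close> can be left out.\<close>

definition short_vecs :: "vec3 list" where
  "short_vecs = List.product [0, 1, -1, 2] (List.product [0, 1, -1, 2] [0, 1, -1, 2])"

definition has_root :: "mat3 \<Rightarrow> int \<Rightarrow> bool" where
  "has_root M t \<longleftrightarrow> det3 (mat3_shift M (- t)) = 0"

text \<open>The halving rounds odd entries down; it is harmless because commutation is tested afterwards.\<close>

definition half_cyclic_with :: "mat3 \<Rightarrow> mat3 \<Rightarrow> bool" where
  "half_cyclic_with M N \<longleftrightarrow>
     (if mat3_mult M N = mat3_mult N M then any (cyclic_vec3 N) unit_vecs else False)"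

text \<open>If \<open>N = (M^2 + x M) / 2\<close> is integral, \<open>M\<close> itself has no cyclic
  vector: an integer matrix commuting with \<open>M\<close> would then be an integer polynomial in
  \<open>M\<close>, and \<open>N\<close> is not. Hence the test with \<open>N\<close> in place of
  \<open>M\<close>.\<close>

definition half_cyclic :: "mat3 \<Rightarrow> int \<Rightarrow> bool" where
  "half_cyclic M x \<longleftrightarrow> half_cyclic_with M (mat3_half (mat3_mult M (mat3_shift M x)))"

definition settled :: "mat3 \<Rightarrow> bool" where
  "settled M \<longleftrightarrow>
     (if any (cyclic_vec3 M) unit_vecs then True
      else if any (has_root M) [0, 1, -1, 2, -2] then True
      else if any (half_cyclic M) [0, 1, -1] then True
      else any (cyclic_vec3 M) short_vecs)"

text \<open>The off-diagonal entries are fixed row by row and the diagonal comes last, so that a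
  zero pattern off the diagonal discards all diagonals at once.\<close>

fun settled_diag :: "int \<Rightarrow> int \<Rightarrow> int \<Rightarrow> int \<Rightarrow> int \<Rightarrow> int \<Rightarrow> int list \<Rightarrow> bool" where
  "settled_diag b c d f g h [a, e, i] = settled ((a, b, c), (d, e, f), (g, h, i))"
| "settled_diag b c d f g h _ = False"

fun settled_row3 :: "int \<Rightarrow> int \<Rightarrow> int \<Rightarrow> int \<Rightarrow> int \<Rightarrow> int list \<Rightarrow> bool" where
  "settled_row3 s b c d f [g, h] =
     (if g = 0 \<and> h = 0 \<or> d = 0 \<and> g = 0 \<or> b = 0 \<and> h = 0 then True
      else list_all (settled_diag b c d f g h) (l1_ball 3 (s - (\<bar>g\<bar> + \<bar>h\<bar>))))"
| "settled_row3 s b c d f _ = False"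

fun settled_row2 :: "int \<Rightarrow> int \<Rightarrow> int \<Rightarrow> int list \<Rightarrow> bool" where
  "settled_row2 s b c [d, f] =
     (if d = 0 \<and> f = 0 \<or> c = 0 \<and> f = 0 then True
      else list_all (settled_row3 (s - (\<bar>d\<bar> + \<bar>f\<bar>)) b c d f) (l1_ball 2 (s - (\<bar>d\<bar> + \<bar>f\<bar>))))"
| "settled_row2 s b c _ = False"

fun settled_row1 :: "int \<Rightarrow> int list \<Rightarrow> bool" where
  "settled_row1 s [b, c] =
     (if b = 0 \<and> c = 0 then True
      else list_all (settled_row2 (s - (\<bar>b\<bar> + \<bar>c\<bar>)) b c) (l1_ball 2 (s - (\<bar>b\<bar> + \<bar>c\<bar>))))"
| "settled_row1 s _ = False"

section \<open>From the finite check to the theorem\<close>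

lemma settled_imp:
  assumes "settled M" and irr: "irreducible (char_poly (map_mat rat_of_int (mat_of_mat3 M)))"
  shows "frobenius_type 3 (mat_of_mat3 M)"
proof -
  consider r where "cyclic_vec3 M r" | t where "has_root M t" | x where "half_cyclic M x"
    using assms(1) unfolding settled_def any_iff by (auto split: if_splits)
  then show ?thesis
  proof cases
    case 1
    then show ?thesis
      using frobenius_type_mat_of_mat3 by blast
  next
    case 2
    then show ?thesis
      using irr not_irreducible_mat_of_mat3 has_root_def by blast
  next
    case 3
    then show ?thesis
      unfolding half_cyclic_def half_cyclic_with_def any_iff
      using frobenius_type_mat_of_mat3 by (metis (full_types))
  qed
qed

text \<open>The exhaustive computation, by rewriting, over norm at most 6 outside the discarded zero
  patterns.\<close>

lemma settled_row1_l1_ball: "list_all (settled_row1 6) (l1_ball 2 6)"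
  by code_simp

text \<open>The second alternative covers the discarded patterns, where the root is a diagonal entry
  and may lie outside the range tried by \<open>settled\<close>.\<close>

lemma settled_or_has_root_if_norm_le_6:
  assumes norm: "\<bar>a\<bar> + \<bar>b\<bar> + \<bar>c\<bar> + (\<bar>d\<bar> + \<bar>e\<bar> + \<bar>f\<bar>) + (\<bar>g\<bar> + \<bar>h\<bar> + \<bar>i\<bar>) \<le> 6"
  shows "settled ((a, b, c), (d, e, f), (g, h, i)) \<or>
    (\<exists>t. has_root ((a, b, c), (d, e, f), (g, h, i)) t)"
proof (cases "b = 0 \<and> c = 0 \<or> b = 0 \<and> h = 0 \<or> c = 0 \<and> f = 0 \<or>
      d = 0 \<and> f = 0 \<or> d = 0 \<and> g = 0 \<or> g = 0 \<and> h = 0")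
  case True
  \<comment> \<open>A row or column that vanishes off the diagonal becomes zero once its diagonal
    entry is subtracted.\<close>
  then have "has_root ((a, b, c), (d, e, f), (g, h, i)) a \<or>
      has_root ((a, b, c), (d, e, f), (g, h, i)) e \<or>
      has_root ((a, b, c), (d, e, f), (g, h, i)) i"
    by (auto simp: has_root_def)
  then show ?thesis by blast
next
  case False
  \<comment> \<open>The norm budgets left after the off-diagonal entries of each row.\<close>
  define s1 where "s1 = 6 - (\<bar>b\<bar> + \<bar>c\<bar>)"
  define s2 where "s2 = s1 - (\<bar>d\<bar> + \<bar>f\<bar>)"
  define s3 where "s3 = s2 - (\<bar>g\<bar> + \<bar>h\<bar>)"
  have diag: "\<bar>a\<bar> + \<bar>e\<bar> + \<bar>i\<bar> \<le> s3"
    using norm by (simp add: s1_def s2_def s3_def)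
  then have row3: "\<bar>g\<bar> + \<bar>h\<bar> \<le> s2"
    using abs_ge_zero[of a] abs_ge_zero[of e] abs_ge_zero[of i] unfolding s3_def by linarith
  then have row2: "\<bar>d\<bar> + \<bar>f\<bar> \<le> s1"
    using abs_ge_zero[of g] abs_ge_zero[of h] unfolding s2_def by linarith
  then have row1: "\<bar>b\<bar> + \<bar>c\<bar> \<le> 6"
    using abs_ge_zero[of d] abs_ge_zero[of f] unfolding s1_def by linarith
  have mem: "[b, c] \<in> set (l1_ball 2 6)" "[d, f] \<in> set (l1_ball 2 s1)"
      "[g, h] \<in> set (l1_ball 2 s2)" "[a, e, i] \<in> set (l1_ball 3 s3)"
    using diag row1 row2 row3 by (auto intro!: in_l1_ballI)
  have "settled_row1 6 [b, c]"
    using settled_row1_l1_ball mem(1) unfolding list_all_iff by blast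
  then have "list_all (settled_row2 s1 b c) (l1_ball 2 s1)"
    using False by (auto simp: s1_def split: if_splits)
  then have "settled_row2 s1 b c [d, f]"
    using mem(2) unfolding list_all_iff by blast
  then have "list_all (settled_row3 s2 b c d f) (l1_ball 2 s2)"
    using False by (auto simp: s2_def split: if_splits)
  then have "settled_row3 s2 b c d f [g, h]"
    using mem(3) unfolding list_all_iff by blast
  then have "list_all (settled_diag b c d f g h) (l1_ball 3 s3)"
    using False by (auto simp: s3_def split: if_splits)
  then have "settled_diag b c d f g h [a, e, i]"
    using mem(4) unfolding list_all_iff by blast
  then show ?thesis by simp
qed

theorem theorem1:
  fixes A :: "int mat"
  assumes "A \<in> irred_int_mats 3"
    and "mat_norm1 A \<le> 6"
  shows "frobenius_type 3 A"
proof -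
  have A: "A \<in> carrier_mat 3 3" and irr: "irreducible (char_poly (map_mat rat_of_int A))"
    using assms(1) by (auto simp: irred_int_mats_def)
  define M where "M = ((A $$ (0, 0), A $$ (0, 1), A $$ (0, 2)),
    (A $$ (1, 0), A $$ (1, 1), A $$ (1, 2)), (A $$ (2, 0), A $$ (2, 1), A $$ (2, 2)))"
  have AM: "A = mat_of_mat3 M"
    using A by (intro eq_matI)
      (auto simp: M_def mat_of_rows_list_def numeral_3_eq_3 numeral_2_eq_2 less_Suc_eq)
  have "settled M \<or> (\<exists>t. has_root M t)"
    unfolding M_def using assms(2) A
    by (intro settled_or_has_root_if_norm_le_6) (simp add: mat_norm1_def numeral_3_eq_3 numeral_2_eq_2)
  then show ?thesis
    using irr settled_imp not_irreducible_mat_of_mat3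
    unfolding AM has_root_def by blast
qed

end
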